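(* Consider the model with government spending, the truncated Markov chain, the terminal condition (return to the intended steady state $c=\pi=0$), and the parameter restrictions described in the context, including $$\psi>m_{x\pi}+\frac{(1-m_{xx})(\beta m_{\pi\pi}-1)}{\kappa(1+\eta\bar c)\sigma}.$$ Let $p\in(0,1)$ and assume $\bar d(p)<d<\bar d(0)$. Let $\underline{\ell}$ be the integer threshold (defined in the context) below which the ELB does not bind. Then the impact multiplier on consumption $m^{c,S}_g(\ell)$ is such that: - $m^{c,S}_g(\ell)=m^{c,N}_g(\ell)$ for $\ell=1,\dots,\underline{\ell}-1$; - there exists a threshold $\ell^{+}$ such that $m^{c,S}_g(\ell)>0$ for all $\ell\geq\ell^{+}$; - $\lim_{\ell\to\infty}m^{c,S}_g(\ell)=m^{c,L}_g(\infty)$ if and only if $p<\bar p$; otherwise $m^{c,S}_g(\ell)$ diverges to $+\infty$ as $\ell\to\infty$.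
   Context: Parameters: $\sigma,\kappa,\eta,\psi,\mu>0$, $\beta\in(0,1)$, $\bar c\in(0,1)$, $m_{xx},m_{x\pi},m_{\pi\pi}\in(0,1]$. Write $K:=\kappa(1+\eta\bar c)$ and $\bar\pi:=-\mu/\psi$. Model: for each date $t$, $$c_t=m_{xx}\mathbb{E}_tc_{t+1}-\sigma(i_t-m_{x\pi}\mathbb{E}_t\pi_{t+1}+d_t),\quad \pi_t=m_{\pi\pi}\beta\,\mathbb{E}_t\pi_{t+1}+Kc_t+\kappa\eta(1-\bar c)g_t,\quad i_t=\max\{\psi\pi_t,-\mu\}.$$ Truncated Markov chain: $d_t$ and $g_t$ are driven by the same chain. At date $t$ the chain starts in the low state, where $(d_t,g_t)=(d,g)$. In periods $t,\dots,t+\ell-1$, from the low state it stays there with probability $p$ and moves to the absorbing state, where $(d_t,g_t)=(0,0)$, with probability $1-p$; the absorbing state is never left. If still in the low state at $t+\ell-1$, it jumps deterministically to the absorbing state at $t+\ell$. Whenever the chain is in the absorbing state, $c=\pi=0$. The equilibrium for given $\ell$ is unique; $\tilde Y_{t+n}(\ell)=[\tilde c_{t+n}(\ell)\ \tilde\pi_{t+n}(\ell)]^\top$, $n=0,\dots,\ell-1$, denotes the allocation at $t+n$ conditional on the low state, and $\tilde Y_{t+\ell}:=0$. Matrices: $$\mathbf{A}=\frac{1}{1+\sigma\psi K}\begin{bmatrix}m_{xx}&\sigma(m_{x\pi}-\psi\beta m_{\pi\pi})\\ Km_{xx}&\beta m_{\pi\pi}+\sigma Km_{x\pi}\end{bmatrix},\quad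 C_d=-\frac{\sigma}{1+\sigma\psi K}\begin{bmatrix}1\\ K\end{bmatrix},\quad C_g=\frac{\kappa\eta(1-\bar c)}{1+\sigma\psi K}\begin{bmatrix}-\sigma\psi\\1\end{bmatrix},$$ $$\mathbf{A}^*=\begin{bmatrix}m_{xx}&\sigma m_{x\pi}\\ Km_{xx}&\beta m_{\pi\pi}+\sigma Km_{x\pi}\end{bmatrix},\quad C^*=-\sigma\begin{bmatrix}1\\ K\end{bmatrix},\quad E^*=\sigma\mu\begin{bmatrix}1\\ K\end{bmatrix},\quad C_g^*=\kappa\eta(1-\bar c)\begin{bmatrix}0\\1\end{bmatrix}.$$ In a low-state period in the normal-time regime ($\tilde\pi_{t+n}>\bar\pi$), $\tilde Y_{t+n}=p\mathbf{A}\tilde Y_{t+n+1}+C_dd+C_gg$; in the ELB regime ($\tilde\pi_{t+n}\leq\bar\pi$), $\tilde Y_{t+n}=p\mathbf{A}^*\tilde Y_{t+n+1}+C^*d+E^*+C_g^*g$. Thresholds: $\bar p$ is the unique root in $(0,1)$ of $F_L(p):=\det(I-p\mathbf{A}^* )=(1-pm_{xx})(1-p\beta m_{\pi\pi})-p\sigma Km_{x\pi}$; parameters are assumed to be such that $F_L(1)<0$, so that this root exists. $\bar d(p):=\mu F_N(p)/(\sigma\psi K)$ with $F_N(p):=(1-pm_{xx})(1-p\beta m_{\pi\pi})+\sigma K(\psi-pm_{x\pi})$. For $\bar d(p)<d<\bar d(0)$ and $g=0$, $\underline{\ell}$ is the finite integer such that for $\ell<\underline{\ell}$ the ELB never binds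 ($\tilde\pi_{t+n}(\ell)>\bar\pi$ for all $n$), while for $\ell\geq\underline{\ell}$ it binds on impact and the path switches exactly once from the ELB regime to the normal-time regime. Multipliers: $m^{c,S}_g(\ell)$ is the derivative with respect to $g$ of impact consumption $\tilde c_t(\ell)$, computed holding fixed in each low-state period the regime (normal-time or ELB) that prevails in the equilibrium with $g=0$ (the increase in $g$ is assumed not large enough to change regimes). $m^{c,N}_g(\ell):=[1\ \ 0]\left[\sum_{i=0}^{\ell-1}(p\mathbf{A})^i\right]C_g$ is the multiplier with the normal-time regime in every low-state period. $m^{c,L}_g(\infty):=[1\ \ 0](I-p\mathbf{A}^* )^{-1}C_g^*$ is the time-invariant ELB multiplier (defined for $p\neq\bar p$). *)

theory Defs
  imports "HOL-Analysis.Analysis" "HOL-Probability.Probability"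
begin

record model =
  sig :: real
  kappa :: real
  eta :: real
  psi :: real
  mu :: real
  beta :: real
  cbar :: real
  mxx :: real
  mxpi :: real
  mpipi :: real

definition admissible :: "model \<Rightarrow> bool" where
  "admissible M \<longleftrightarrow>
     sig M > 0 \<and> kappa M > 0 \<and> eta M > 0 \<and> psi M > 0 \<and> mu M > 0 \<and>
     0 < beta M \<and> beta M < 1 \<and> 0 < cbar M \<and> cbar M < 1 \<and>
     0 < mxx M \<and> mxx M \<le> 1 \<and> 0 < mxpi M \<and> mxpi M \<le> 1 \<and> 0 < mpipi M \<and> mpipi M \<le> 1"

definition K :: "model \<Rightarrow> real" where
  "K M = kappa M * (1 + eta M * cbar M)"

definition pibar :: "model \<Rightarrow> real" where
  "pibar M = - mu M / psi M"

datatype state = Low | Absorbing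

text \<open>
  Dates are measured relative to the date \<open>t\<close> at which the chain starts in the low state.
  \<open>transition p l n s\<close> is the distribution of the state at date \<open>n + 1\<close> given state \<open>s\<close> at
  date \<open>n\<close>. The last date at which the low state can occur is \<open>l - 1\<close>.
\<close>

definition transition :: "real \<Rightarrow> nat \<Rightarrow> nat \<Rightarrow> state \<Rightarrow> state pmf" where
  "transition p l n s =
     (if s = Low \<and> n + 1 < l
      then map_pmf (\<lambda>stay. if stay then Low else Absorbing) (bernoulli_pmf p)
      else return_pmf Absorbing)"

definition shock :: "real \<Rightarrow> state \<Rightarrow> real" where
  "shock x s = (if s = Low then x else 0)"

definition policy_rate :: "model \<Rightarrow> real \<Rightarrow> real" where
  "policy_rate M infl = max (psi M * infl) (- mu M)"

text \<open>
  An allocation assigns to each date and state the vector of consumption (component 1) and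
  inflation (component 2). The low state cannot be reached at dates \<open>n \<ge> l\<close>; there the
  allocation is normalised to 0.
\<close>

definition equilibrium ::
    "model \<Rightarrow> real \<Rightarrow> real \<Rightarrow> real \<Rightarrow> nat \<Rightarrow> (nat \<Rightarrow> state \<Rightarrow> real^2) \<Rightarrow> bool" where
  "equilibrium M p d g l Y \<longleftrightarrow>
     (\<forall>n s. (s = Low \<longrightarrow> n < l) \<longrightarrow>
        (let Ec = measure_pmf.expectation (transition p l n s) (\<lambda>s'. Y (n + 1) s' $ 1);
             Epi = measure_pmf.expectation (transition p l n s) (\<lambda>s'. Y (n + 1) s' $ 2)
         in Y n s $ 1 = mxx M * Ec
              - sig M * (policy_rate M (Y n s $ 2) - mxpi M * Epi + shock d s) \<and>
            Y n s $ 2 = mpipi M * beta M * Epi + K M * (Y n s $ 1)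
              + kappa M * eta M * (1 - cbar M) * shock g s)) \<and>
     (\<forall>n. Y n Absorbing = 0) \<and>
     (\<forall>n\<ge>l. Y n Low = 0)"

definition low_alloc :: "model \<Rightarrow> real \<Rightarrow> real \<Rightarrow> real \<Rightarrow> nat \<Rightarrow> nat \<Rightarrow> real^2" where
  "low_alloc M p d g l n = (THE Y. equilibrium M p d g l Y) n Low"

definition elb_binds :: "model \<Rightarrow> real \<Rightarrow> real \<Rightarrow> nat \<Rightarrow> nat \<Rightarrow> bool" where
  "elb_binds M p d l n \<longleftrightarrow> low_alloc M p d 0 l n $ 2 \<le> pibar M"

definition mat_A :: "model \<Rightarrow> real^2^2" where
  "mat_A M = (1 / (1 + sig M * psi M * K M)) *\<^sub>R
     vector [vector [mxx M, sig M * (mxpi M - psi M * beta M * mpipi M)],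
             vector [K M * mxx M, beta M * mpipi M + sig M * K M * mxpi M]]"

definition vec_Cd :: "model \<Rightarrow> real^2" where
  "vec_Cd M = (- sig M / (1 + sig M * psi M * K M)) *\<^sub>R vector [1, K M]"

definition vec_Cg :: "model \<Rightarrow> real^2" where
  "vec_Cg M = (kappa M * eta M * (1 - cbar M) / (1 + sig M * psi M * K M)) *\<^sub>R
     vector [- sig M * psi M, 1]"

definition mat_A_elb :: "model \<Rightarrow> real^2^2" where
  "mat_A_elb M =
     vector [vector [mxx M, sig M * mxpi M],
             vector [K M * mxx M, beta M * mpipi M + sig M * K M * mxpi M]]"

definition vec_C_elb :: "model \<Rightarrow> real^2" where
  "vec_C_elb M = (- sig M) *\<^sub>R vector [1, K M]"

definition vec_E_elb :: "model \<Rightarrow> real^2" where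
  "vec_E_elb M = (sig M * mu M) *\<^sub>R vector [1, K M]"

definition vec_Cg_elb :: "model \<Rightarrow> real^2" where
  "vec_Cg_elb M = (kappa M * eta M * (1 - cbar M)) *\<^sub>R vector [0, 1]"

definition normal_step :: "model \<Rightarrow> real \<Rightarrow> real \<Rightarrow> real \<Rightarrow> real^2 \<Rightarrow> real^2" where
  "normal_step M p d g Y = (p *\<^sub>R mat_A M) *v Y + d *\<^sub>R vec_Cd M + g *\<^sub>R vec_Cg M"

definition elb_step :: "model \<Rightarrow> real \<Rightarrow> real \<Rightarrow> real \<Rightarrow> real^2 \<Rightarrow> real^2" where
  "elb_step M p d g Y =
     (p *\<^sub>R mat_A_elb M) *v Y + d *\<^sub>R vec_C_elb M + vec_E_elb M + g *\<^sub>R vec_Cg_elb M"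

text \<open>The power \<open>A ^ i\<close> on \<open>real^2^2\<close> is componentwise, hence the following.\<close>

primrec mat_pow :: "real^'n^'n \<Rightarrow> nat \<Rightarrow> real^'n^'n" where
  "mat_pow A 0 = mat 1"
| "mat_pow A (Suc i) = A ** mat_pow A i"

definition F_L :: "model \<Rightarrow> real \<Rightarrow> real" where
  "F_L M p = det (mat 1 - p *\<^sub>R mat_A_elb M)"

definition p_bar :: "model \<Rightarrow> real" where
  "p_bar M = (THE p. 0 < p \<and> p < 1 \<and> F_L M p = 0)"

definition F_N :: "model \<Rightarrow> real \<Rightarrow> real" where
  "F_N M p = (1 - p * mxx M) * (1 - p * beta M * mpipi M)
     + sig M * K M * (psi M - p * mxpi M)"

definition d_bar :: "model \<Rightarrow> real \<Rightarrow> real" where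
  "d_bar M p = mu M * F_N M p / (sig M * psi M * K M)"

definition is_elb_threshold :: "model \<Rightarrow> real \<Rightarrow> real \<Rightarrow> nat \<Rightarrow> bool" where
  "is_elb_threshold M p d L \<longleftrightarrow>
     1 \<le> L \<and>
     (\<forall>l. 1 \<le> l \<and> l < L \<longrightarrow> (\<forall>n<l. \<not> elb_binds M p d l n)) \<and>
     (\<forall>l\<ge>L. elb_binds M p d l 0 \<and>
        (\<exists>k. 0 < k \<and> k < l \<and> (\<forall>n<k. elb_binds M p d l n) \<and>
             (\<forall>n. k \<le> n \<and> n < l \<longrightarrow> \<not> elb_binds M p d l n)))"

definition l_low :: "model \<Rightarrow> real \<Rightarrow> real \<Rightarrow> nat" where
  "l_low M p d = (THE L. is_elb_threshold M p d L)"

text \<open>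
  \<open>fixed_regime_alloc M p d g R l k\<close> is the low-state allocation with \<open>k\<close> low-state periods
  remaining, that is at date \<open>l - k\<close>, when the ELB regime is imposed at exactly those dates
  \<open>n\<close> with \<open>R n\<close>. The allocation on impact is the case \<open>k = l\<close>.
\<close>

primrec fixed_regime_alloc ::
    "model \<Rightarrow> real \<Rightarrow> real \<Rightarrow> real \<Rightarrow> (nat \<Rightarrow> bool) \<Rightarrow> nat \<Rightarrow> nat \<Rightarrow> real^2" where
  "fixed_regime_alloc M p d g R l 0 = 0"
| "fixed_regime_alloc M p d g R l (Suc k) =
     (if R (l - Suc k) then elb_step M p d g (fixed_regime_alloc M p d g R l k)
      else normal_step M p d g (fixed_regime_alloc M p d g R l k))"

definition m_S :: "model \<Rightarrow> real \<Rightarrow> real \<Rightarrow> nat \<Rightarrow> real" where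
  "m_S M p d l = deriv (\<lambda>g. fixed_regime_alloc M p d g (elb_binds M p d l) l l $ 1) 0"

definition m_N :: "model \<Rightarrow> real \<Rightarrow> nat \<Rightarrow> real" where
  "m_N M p l = ((\<Sum>i<l. mat_pow (p *\<^sub>R mat_A M) i) *v vec_Cg M) $ 1"

definition m_L :: "model \<Rightarrow> real \<Rightarrow> real" where
  "m_L M p = (matrix_inv (mat 1 - p *\<^sub>R mat_A_elb M) *v vec_Cg_elb M) $ 1"

lemma K_pos: "admissible M \<Longrightarrow> K M > 0"
  by (simp add: admissible_def K_def add_pos_pos)

lemma F_L_eq:
  "F_L M p = (1 - p * mxx M) * (1 - p * beta M * mpipi M) - p * sig M * K M * mxpi M"
  by (simp add: F_L_def det_2 mat_A_elb_def mat_def algebra_simps)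

lemma p_bar_ex1:
  assumes "admissible M" "F_L M 1 < 0"
  shows "\<exists>!p. 0 < p \<and> p < 1 \<and> F_L M p = 0"
proof -
  define a where "a = mxx M * beta M * mpipi M"
  define b where "b = mxx M + beta M * mpipi M + sig M * K M * mxpi M"
  have F: "F_L M p = 1 - b * p + a * p\<^sup>2" for p
    by (simp add: F_L_eq a_def b_def algebra_simps power2_eq_square)
  have a: "a > 0"
    using assms(1) by (simp add: a_def admissible_def)
  have "\<exists>p\<ge>0. p \<le> 1 \<and> F_L M p = 0"
  proof (rule IVT2)
    show "F_L M 1 \<le> 0" "0 \<le> F_L M 0"
      using assms(2) by (simp_all add: F)
    show "\<forall>p. 0 \<le> p \<and> p \<le> 1 \<longrightarrow> isCont (F_L M) p"
      unfolding F[abs_def] by (intro allI impI continuous_intros)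
  qed simp
  then obtain p where p: "0 \<le> p" "p \<le> 1" "F_L M p = 0"
    by blast
  have ne: "p \<noteq> 0" "p \<noteq> 1"
    using p(3) assms(2) by (auto simp: F)
  have "q = r" if "0 < q" "q < 1" "F_L M q = 0" "0 < r" "r < 1" "F_L M r = 0" for q r
  proof (rule ccontr)
    assume "q \<noteq> r"
    have "(q - r) * (a * (q + r) - b) = 0"
      using that(3,6) by (simp add: F algebra_simps power2_eq_square)
    then have b: "b = a * (q + r)"
      using \<open>q \<noteq> r\<close> by simp
    then have qr: "a * q * r = 1"
      using that(3) by (simp add: F algebra_simps power2_eq_square)
    have "F_L M 1 = a * ((1 - q) * (1 - r))"
      using b qr by (simp add: F algebra_simps)
    moreover have "a * ((1 - q) * (1 - r)) > 0"
      using a that by simp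
    ultimately show False
      using assms(2) by simp
  qed
  moreover have "0 < p \<and> p < 1 \<and> F_L M p = 0"
    using p ne by auto
  ultimately show ?thesis
    by blast
qed

lemma step_iff:
  fixes Y Y' :: "real^2"
  assumes adm: "admissible M"
  shows "(Y $ 1 = mxx M * (p * Y' $ 1)
            - sig M * (policy_rate M (Y $ 2) - mxpi M * (p * Y' $ 2) + d) \<and>
          Y $ 2 = mpipi M * beta M * (p * Y' $ 2) + K M * (Y $ 1)
            + kappa M * eta M * (1 - cbar M) * g) \<longleftrightarrow>
         Y = (if elb_step M p d g Y' $ 2 \<le> pibar M then elb_step M p d g Y'
              else normal_step M p d g Y')"
  (is "?eqs \<longleftrightarrow> Y = ?F")
proof -
  define s where "s = sig M"
  define k where "k = K M"
  define f where "f = psi M"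
  define u where "u = mu M"
  define a where "a = mxx M * (p * Y' $ 1) + s * mxpi M * (p * Y' $ 2) - s * d"
  define b where "b = mpipi M * beta M * (p * Y' $ 2) + kappa M * eta M * (1 - cbar M) * g"
  define D where "D = 1 + s * f * k"
  have pos: "s > 0" "k > 0" "f > 0" "u > 0" "D > 0" "s * f * k > 0"
    using adm K_pos[OF adm] by (auto simp: s_def k_def f_def u_def D_def admissible_def add_pos_pos)
  have e1: "elb_step M p d g Y' $ 1 = a + s * u"
    by (simp add: elb_step_def mat_A_elb_def vec_C_elb_def vec_E_elb_def vec_Cg_elb_def
        matrix_vector_mult_def sum_2 a_def s_def u_def algebra_simps)
  have e2: "elb_step M p d g Y' $ 2 = b + k * (a + s * u)"
    by (simp add: elb_step_def mat_A_elb_def vec_C_elb_def vec_E_elb_def vec_Cg_elb_def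
        matrix_vector_mult_def sum_2 a_def b_def s_def k_def u_def algebra_simps)
  have Dm: "1 + sig M * psi M * K M = D"
    by (simp add: D_def s_def k_def f_def)
  have n1: "normal_step M p d g Y' $ 1 = (a - s * f * b) / D"
    unfolding normal_step_def mat_A_def vec_Cd_def vec_Cg_def Dm a_def b_def s_def k_def f_def
    by (simp add: matrix_vector_mult_def sum_2 add_divide_distrib diff_divide_distrib algebra_simps)
  have n2: "normal_step M p d g Y' $ 2 = (b + k * a) / D"
    unfolding normal_step_def mat_A_def vec_Cd_def vec_Cg_def Dm a_def b_def s_def k_def f_def
    by (simp add: matrix_vector_mult_def sum_2 add_divide_distrib diff_divide_distrib algebra_simps)
  have pib: "x \<le> pibar M \<longleftrightarrow> f * x \<le> - u" for x
    using pos by (simp add: pibar_def f_def u_def field_simps)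
  have eqs: "?eqs \<longleftrightarrow> Y $ 1 = a - s * max (f * Y $ 2) (- u) \<and> Y $ 2 = b + k * Y $ 1"
    by (auto simp: policy_rate_def a_def b_def s_def k_def f_def u_def algebra_simps)
  show ?thesis
  proof (cases "elb_step M p d g Y' $ 2 \<le> pibar M")
    case True
    then have le: "f * (b + k * (a + s * u)) \<le> - u"
      by (simp add: pib e2)
    have "Y $ 1 = a - s * max (f * Y $ 2) (- u) \<and> Y $ 2 = b + k * Y $ 1 \<longleftrightarrow>
          Y $ 1 = a + s * u \<and> Y $ 2 = b + k * (a + s * u)"
    proof
      assume *: "Y $ 1 = a - s * max (f * Y $ 2) (- u) \<and> Y $ 2 = b + k * Y $ 1"
      have "s * (- u) \<le> s * max (f * Y $ 2) (- u)"
        using pos by (intro mult_left_mono) auto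
      then have "Y $ 1 \<le> a + s * u"
        using *[THEN conjunct1] by linarith
      then have "k * Y $ 1 \<le> k * (a + s * u)"
        using pos by (intro mult_left_mono) auto
      then have "Y $ 2 \<le> b + k * (a + s * u)"
        using *[THEN conjunct2] by linarith
      then have "f * Y $ 2 \<le> f * (b + k * (a + s * u))"
        using pos by (intro mult_left_mono) auto
      then have m: "max (f * Y $ 2) (- u) = - u"
        using le by linarith
      have y1: "Y $ 1 = a + s * u"
        using *[THEN conjunct1] unfolding m by simp
      show "Y $ 1 = a + s * u \<and> Y $ 2 = b + k * (a + s * u)"
        using *[THEN conjunct2] y1 unfolding y1 by simp
    next
      assume "Y $ 1 = a + s * u \<and> Y $ 2 = b + k * (a + s * u)"
      then show "Y $ 1 = a - s * max (f * Y $ 2) (- u) \<and> Y $ 2 = b + k * Y $ 1"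
        using le by simp
    qed
    then show ?thesis
      using True eqs by (simp add: vec_eq_iff forall_2 e1 e2)
  next
    case False
    then have gt: "f * (b + k * (a + s * u)) > - u"
      by (simp add: pib e2)
    have "Y $ 1 = a - s * max (f * Y $ 2) (- u) \<and> Y $ 2 = b + k * Y $ 1 \<longleftrightarrow>
          Y $ 1 = (a - s * f * b) / D \<and> Y $ 2 = (b + k * a) / D"
    proof
      assume *: "Y $ 1 = a - s * max (f * Y $ 2) (- u) \<and> Y $ 2 = b + k * Y $ 1"
      have "f * Y $ 2 > - u"
      proof (rule ccontr)
        assume "\<not> f * Y $ 2 > - u"
        then have m: "max (f * Y $ 2) (- u) = - u" and le: "f * Y $ 2 \<le> - u"
          by simp_all
        have y1: "Y $ 1 = a + s * u"
          using *[THEN conjunct1] unfolding m by simp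
        have y2: "Y $ 2 = b + k * (a + s * u)"
          using *[THEN conjunct2] unfolding y1 .
        show False
          using gt le unfolding y2 by linarith
      qed
      then have m: "max (f * Y $ 2) (- u) = f * Y $ 2"
        by simp
      have y1: "Y $ 1 = a - s * (f * Y $ 2)"
        using *[THEN conjunct1] unfolding m .
      have y2: "Y $ 2 = b + k * Y $ 1"
        using *[THEN conjunct2] .
      have "Y $ 1 = a - s * f * b - s * f * k * Y $ 1"
        by (subst y1, subst y2) (simp add: algebra_simps)
      then have "Y $ 1 * D = a - s * f * b"
        unfolding D_def by (simp only: distrib_left) (simp add: mult.commute)
      moreover have "Y $ 2 = b + k * a - s * f * k * Y $ 2"
        by (subst y2, subst y1) (simp add: algebra_simps)
      then have "Y $ 2 * D = b + k * a"
        unfolding D_def by (simp only: distrib_left) (simp add: mult.commute)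
      ultimately show "Y $ 1 = (a - s * f * b) / D \<and> Y $ 2 = (b + k * a) / D"
        using pos(5) by (auto simp: eq_divide_eq)
    next
      assume *: "Y $ 1 = (a - s * f * b) / D \<and> Y $ 2 = (b + k * a) / D"
      have "f * (b + k * a) > - u * D"
        using gt by (simp add: D_def algebra_simps)
      then have "- u < f * (b + k * a) / D"
        using pos(5) by (simp only: pos_less_divide_eq)
      then have "f * Y $ 2 > - u"
        using * by simp
      then have m: "max (f * Y $ 2) (- u) = f * Y $ 2"
        by simp
      have "(a - s * f * b) / D = a - s * (f * ((b + k * a) / D))"
        using pos(5) by (simp add: D_def field_simps)
      moreover have "(b + k * a) / D = b + k * ((a - s * f * b) / D)"
        using pos(5) by (simp add: D_def field_simps)
      ultimately show "Y $ 1 = a - s * max (f * Y $ 2) (- u) \<and> Y $ 2 = b + k * Y $ 1"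
        unfolding m unfolding *[THEN conjunct1] *[THEN conjunct2] by blast
    qed
    then show ?thesis
      using False eqs by (simp add: vec_eq_iff forall_2 n1 n2)
  qed
qed

lemma expectation_Low:
  assumes "0 \<le> p" "p \<le> 1" "n < l" "f Absorbing = 0" "n + 1 = l \<Longrightarrow> f Low = 0"
  shows "measure_pmf.expectation (transition p l n Low) f = p * (f Low :: real)"
  using assms by (cases "n + 1 < l") (auto simp: transition_def)

lemma expectation_Absorbing:
  "measure_pmf.expectation (transition p l n Absorbing) f = (f Absorbing :: real)"
  by (simp add: transition_def)

lemma equilibrium_iff:
  assumes adm: "admissible M" and p: "0 \<le> p" "p \<le> 1"
  shows "equilibrium M p d g l Y \<longleftrightarrow>
    (\<forall>n<l. Y n Low = (if elb_step M p d g (Y (n + 1) Low) $ 2 \<le> pibar M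
                      then elb_step M p d g (Y (n + 1) Low)
                      else normal_step M p d g (Y (n + 1) Low))) \<and>
    (\<forall>n. Y n Absorbing = 0) \<and> (\<forall>n\<ge>l. Y n Low = 0)"
proof (cases "(\<forall>n. Y n Absorbing = 0) \<and> (\<forall>n\<ge>l. Y n Low = 0)")
  case True
  then have abs: "Y n Absorbing = 0" and out: "n \<ge> l \<Longrightarrow> Y n Low = 0" for n
    by auto
  have E: "measure_pmf.expectation (transition p l n Low) (\<lambda>s'. Y (n + 1) s' $ i)
           = p * Y (n + 1) Low $ i" if "n < l" for n i
    using expectation_Low[OF p that, of "\<lambda>s'. Y (n + 1) s' $ i"] abs out by simp
  have mu: "mu M > 0"
    using adm by (simp add: admissible_def)
  have "equilibrium M p d g l Y \<longleftrightarrow>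
     (\<forall>n<l. Y n Low $ 1 = mxx M * (p * Y (n + 1) Low $ 1)
            - sig M * (policy_rate M (Y n Low $ 2) - mxpi M * (p * Y (n + 1) Low $ 2) + d) \<and>
          Y n Low $ 2 = mpipi M * beta M * (p * Y (n + 1) Low $ 2) + K M * (Y n Low $ 1)
            + kappa M * eta M * (1 - cbar M) * g)" (is "?l = ?r")
  proof
    assume ?l
    show ?r
    proof (intro allI impI)
      fix n assume "n < l"
      then show "Y n Low $ 1 = mxx M * (p * Y (n + 1) Low $ 1)
            - sig M * (policy_rate M (Y n Low $ 2) - mxpi M * (p * Y (n + 1) Low $ 2) + d) \<and>
          Y n Low $ 2 = mpipi M * beta M * (p * Y (n + 1) Low $ 2) + K M * (Y n Low $ 1)
            + kappa M * eta M * (1 - cbar M) * g"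
        using \<open>?l\<close>[unfolded equilibrium_def, THEN conjunct1, rule_format, of Low n]
        unfolding Let_def E[OF \<open>n < l\<close>] shock_def if_True simp_thms by blast
    qed
  next
    assume r: ?r
    show ?l
      unfolding equilibrium_def
    proof (intro conjI allI impI)
      fix n s assume "s = Low \<longrightarrow> n < l"
      then show "let Ec = measure_pmf.expectation (transition p l n s) (\<lambda>s'. Y (n + 1) s' $ 1);
             Epi = measure_pmf.expectation (transition p l n s) (\<lambda>s'. Y (n + 1) s' $ 2)
         in Y n s $ 1 = mxx M * Ec
              - sig M * (policy_rate M (Y n s $ 2) - mxpi M * Epi + shock d s) \<and>
            Y n s $ 2 = mpipi M * beta M * Epi + K M * (Y n s $ 1)
              + kappa M * eta M * (1 - cbar M) * shock g s"
      proof (cases s)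
        case Low
        then have "n < l"
          using \<open>s = Low \<longrightarrow> n < l\<close> by simp
        show ?thesis
          unfolding Low Let_def E[OF \<open>n < l\<close>] shock_def if_True simp_thms
          using r[rule_format, OF \<open>n < l\<close>] .
      next
        case Absorbing
        then show ?thesis
          using mu by (simp add: Let_def shock_def expectation_Absorbing abs policy_rate_def)
      qed
    qed (use True in auto)
  qed
  then show ?thesis
    using True by (simp only: step_iff[OF adm]) simp
next
  case False
  then show ?thesis
    by (auto simp: equilibrium_def)
qed

lemma equilibrium_ex1:
  assumes adm: "admissible M" and p: "0 \<le> p" "p \<le> 1"
  shows "\<exists>!Y. equilibrium M p d g l Y"
proof -
  define F where "F y = (if elb_step M p d g y $ 2 \<le> pibar M then elb_step M p d g y
                         else normal_step M p d g y)" for y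
  define Y0 where "Y0 n s = (if s = Low then (F ^^ (l - n)) 0 else 0)" for n s
  have iff: "equilibrium M p d g l Y \<longleftrightarrow>
      (\<forall>n<l. Y n Low = F (Y (n + 1) Low)) \<and> (\<forall>n. Y n Absorbing = 0) \<and> (\<forall>n\<ge>l. Y n Low = 0)" for Y
    unfolding F_def by (rule equilibrium_iff[OF adm p])
  show ?thesis
  proof (rule ex1I[of _ Y0])
    have "(F ^^ (l - n)) 0 = F ((F ^^ (l - Suc n)) 0)" if "n < l" for n
      using that by (simp add: Suc_diff_Suc[symmetric])
    then show "equilibrium M p d g l Y0"
      by (auto simp: iff Y0_def)
  next
    fix Y assume "equilibrium M p d g l Y"
    then have Y: "\<And>n. n < l \<Longrightarrow> Y n Low = F (Y (n + 1) Low)" "\<And>n. Y n Absorbing = 0"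
        "\<And>n. n \<ge> l \<Longrightarrow> Y n Low = 0"
      by (auto simp: iff)
    have low: "l - n = k \<Longrightarrow> Y n Low = (F ^^ k) 0" for n k
    proof (induction k arbitrary: n)
      case 0
      then show ?case using Y(3) by simp
    next
      case (Suc k)
      then have "n < l" "l - (n + 1) = k" by auto
      then show ?case using Y(1) Suc.IH[of "n + 1"] by simp
    qed
    show "Y = Y0"
    proof (intro ext)
      fix n s show "Y n s = Y0 n s"
        using Y(2) low by (cases s) (auto simp: Y0_def)
    qed
  qed
qed

end

theory Submission
  imports Defs
begin

text \<open>
  Reading time backwards from the end of the shock and eliminating consumption, inflation solves a
  second-order recursion. In the normal-time regime it falls by at least a fixed amount per period,
  so it crosses the ELB at some number \<open>L\<close> of remaining periods, and it never returns above the ELB: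
  if \<open>F_L > 0\<close> it falls towards, or stays below, the ELB steady state, and if \<open>F_L \<le> 0\<close> it falls
  forever. Hence the regime depends only on the number of remaining periods, and the multiplier is
  the impulse response of a normal phase of length \<open>L - 1\<close> followed by the ELB recursion. The
  latter has positive characteristic roots \<open>z1 < 1\<close> and \<open>z2\<close>, where \<open>z2 < 1\<close> iff \<open>F_L > 0\<close> iff
  \<open>p < p_bar\<close>. If \<open>z2 < 1\<close> the multiplier converges to the positive steady-state value. If
  \<open>z2 \<ge> 1\<close> it diverges to \<open>+\<infinity>\<close>, because the \<open>z2\<close>-component is positive on entry into the ELB
  regime: during the normal phase the inflation multiplier is a negative multiple of
  \<open>P k - x * P (k - 1)\<close>, so its behaviour is controlled by the decline of inflation before \<open>L\<close>.
\<close>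

section \<open>Affine recursions with a convergent forcing term\<close>

text \<open>The distance to the fixed point of the limiting recursion contracts by
  \<open>\<bar>\<theta>\<bar>\<close>, up to an error that tends to 0. The recursion is assumed only
  from \<open>N\<close> on because the ELB recursion starts at \<open>L\<close>.\<close>

lemma affine_recursion_tendsto:
  fixes r b :: "nat \<Rightarrow> real"
  assumes rec: "\<And>k. k \<ge> N \<Longrightarrow> r (Suc k) = \<theta> * r k + b k"
    and \<theta>: "\<bar>\<theta>\<bar> < 1" and b: "b \<longlonglongrightarrow> B"
  shows "r \<longlonglongrightarrow> B / (1 - \<theta>)"
proof -
  define R where "R = B / (1 - \<theta>)"
  define e where "e k = \<bar>r k - R\<bar>" for k
  have R: "R = \<theta> * R + B"
    using \<theta> by (simp add: R_def field_simps)
  have step: "e (Suc k) \<le> \<bar>\<theta>\<bar> * e k + \<bar>b k - B\<bar>" if "k \<ge> N" for k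
  proof -
    have "r (Suc k) - R = \<theta> * (r k - R) + (b k - B)"
      using rec[OF that] R by (simp add: algebra_simps)
    then show ?thesis
      unfolding e_def by (metis abs_mult abs_triangle_ineq)
  qed
  have "e \<longlonglongrightarrow> 0"
  proof (rule LIMSEQ_I)
    fix \<epsilon> :: real assume "\<epsilon> > 0"
    \<comment> \<open>Chosen so that
      \<open>\<bar>\<theta>\<bar> * (\<epsilon> / 2) + h = \<epsilon> / 2\<close>: the bound
      reproduces itself.\<close>
    define h where "h = (1 - \<bar>\<theta>\<bar>) * (\<epsilon> / 2)"
    have "h > 0"
      using \<theta> \<open>\<epsilon> > 0\<close> by (simp add: h_def)
    then obtain N' where N': "\<And>k. k \<ge> N' \<Longrightarrow> \<bar>b k - B\<bar> < h"
      using LIMSEQ_D[OF b] by auto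
    obtain m where m: "N \<le> m" "N' \<le> m"
      using max.cobounded1 max.cobounded2 by blast
    have bound: "e (m + j) \<le> \<bar>\<theta>\<bar> ^ j * e m + \<epsilon> / 2" for j
    proof (induction j)
      case 0
      then show ?case using \<open>\<epsilon> > 0\<close> by simp
    next
      case (Suc j)
      have "e (m + Suc j) \<le> \<bar>\<theta>\<bar> * e (m + j) + h"
        using step[of "m + j"] N'[of "m + j"] m by simp
      also have "\<dots> \<le> \<bar>\<theta>\<bar> * (\<bar>\<theta>\<bar> ^ j * e m + \<epsilon> / 2) + h"
        using Suc by (intro add_right_mono mult_left_mono) auto
      also have "\<dots> = \<bar>\<theta>\<bar> ^ Suc j * e m + \<epsilon> / 2"
        by (simp add: h_def algebra_simps add_divide_distrib diff_divide_distrib)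
      finally show ?case .
    qed
    have "(\<lambda>j. \<bar>\<theta>\<bar> ^ j * e m) \<longlonglongrightarrow> 0"
      using \<theta> by (intro tendsto_mult_left_zero LIMSEQ_power_zero) simp
    then obtain J where J: "\<And>j. j \<ge> J \<Longrightarrow> \<bar>\<bar>\<theta>\<bar> ^ j * e m\<bar> < \<epsilon> / 2"
      using LIMSEQ_D[of "\<lambda>j. \<bar>\<theta>\<bar> ^ j * e m" 0 "\<epsilon> / 2"] \<open>\<epsilon> > 0\<close> by auto
    have "\<bar>e k\<bar> < \<epsilon>" if "k \<ge> m + J" for k
    proof -
      have j: "k = m + (k - m)" "k - m \<ge> J"
        using that by simp_all
      show ?thesis
        using bound[of "k - m"] J[OF j(2)] that by (simp add: e_def)
    qed
    then show "\<exists>no. \<forall>n\<ge>no. norm (e n - 0) < \<epsilon>"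
      by auto
  qed
  then have "(\<lambda>k. r k - R) \<longlonglongrightarrow> 0"
    unfolding e_def by (rule tendsto_rabs_zero_cancel)
  then show ?thesis
    unfolding R_def by (rule LIM_zero_cancel)
qed

section \<open>The inflation path: decline, crossing and staying at the ELB\<close>

text \<open>
  \<open>P k\<close> is low-state inflation with \<open>k\<close> low-state periods remaining. Consumption is eliminated
  with the Phillips curve, which turns the model into a second-order recursion in inflation alone;
  \<open>P (k - 1)\<close> with truncated subtraction gives the right initial condition at \<open>k = 0\<close>.
\<close>

locale inflation_path =
  fixes x a q s \<psi> \<mu> d :: real and P :: "nat \<Rightarrow> real"
  assumes x: "0 < x" "x < 1" and a: "0 < a" "a < 1" and q: "0 < q"
    and s: "0 < s" and \<psi>: "0 < \<psi>" and \<mu>: "0 < \<mu>"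
    and P_0: "P 0 = 0"
    and P_Suc: "P (Suc k) + s * max (\<psi> * P (Suc k)) (- \<mu>)
                  = (x + a + s * q) * P k - x * a * P (k - 1) - s * d"
    and F_N_pos: "0 < (1 - x) * (1 - a) + s * (\<psi> - q)"
    and d_lower: "\<mu> * ((1 - x) * (1 - a) + s * (\<psi> - q)) < s * \<psi> * d"
    and d_upper: "s * \<psi> * d < \<mu> * (1 + s * \<psi>)"
begin

text \<open>\<open>T\<close> and \<open>x * a\<close> are the trace and determinant of the ELB
  transition matrix, so \<open>FL\<close> is its characteristic polynomial at 1;
  \<open>FN / D\<close> is the analogue for the normal-time matrix. Positive \<open>slack\<close>
  says that the normal-time steady state \<open>- s * d / FN\<close> lies below
  \<open>bar\<close>.\<close>

definition T where "T = x + a + s * q"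
definition D where "D = 1 + s * \<psi>"
definition FL where "FL = 1 - T + x * a"
definition FN where "FN = D - T + x * a"
definition bar where "bar = - \<mu> / \<psi>"
definition rhs where "rhs k = T * P k - x * a * P (k - 1) - s * d"
definition slack where "slack = FN * bar + s * d"

lemma D_gt_1: "D > 1"
  using s \<psi> by (simp add: D_def)

lemma xa: "0 < x * a" "x * a < 1"
  using x a mult_strict_mono[of x 1 a 1] by auto

lemma bar_neg: "bar < 0"
  using \<psi> \<mu> by (simp add: bar_def)

lemma \<psi>_bar: "\<psi> * bar = - \<mu>"
  using \<psi> by (simp add: bar_def)

lemma D_bar: "D * bar = bar - s * \<mu>"
  using \<psi>_bar by (simp add: D_def distrib_right mult.assoc)

lemma FN_pos: "FN > 0"
  using F_N_pos by (simp add: FN_def D_def T_def algebra_simps)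

lemma FN_eq: "FN = FL + s * \<psi>"
  by (simp add: FN_def FL_def D_def)

lemma slack_pos: "slack > 0"
proof -
  have "\<mu> * FN < s * \<psi> * d"
    using d_lower by (simp add: FN_def D_def T_def algebra_simps)
  moreover have "\<psi> * slack = FN * (\<psi> * bar) + s * \<psi> * d"
    by (simp add: slack_def algebra_simps)
  ultimately have "\<psi> * slack > 0"
    by (simp add: \<psi>_bar mult.commute)
  then show ?thesis
    using \<psi> by (simp add: zero_less_mult_iff)
qed

text \<open>The two regimes agree at inflation \<open>bar\<close>, so \<open>slack\<close> can also
  be read in the ELB regime: for \<open>FL > 0\<close> its positivity puts the ELB steady state
  below \<open>bar\<close>.\<close>

lemma slack_eq: "slack = FL * bar + s * (d - \<mu>)"
proof -
  have "s * \<psi> * bar = - s * \<mu>"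
    using \<psi>_bar by (simp add: mult.assoc)
  then show ?thesis
    by (simp add: slack_def FN_eq algebra_simps)
qed

lemma d_pos: "d > 0"
proof -
  have "0 < \<mu> * ((1 - x) * (1 - a) + s * (\<psi> - q))"
    using \<mu> F_N_pos by simp
  then have "0 < s * \<psi> * d"
    using d_lower by linarith
  then show ?thesis
    using zero_less_mult_pos[of "s * \<psi>" d] s \<psi> by simp
qed

lemma path: "P (Suc k) + s * max (\<psi> * P (Suc k)) (- \<mu>) = rhs k"
  using P_Suc by (simp add: rhs_def T_def)

lemma le_bar_iff: "y \<le> bar \<longleftrightarrow> \<psi> * y \<le> - \<mu>"
  using \<psi> by (simp add: bar_def field_simps)

lemma P_elb: "P (Suc k) \<le> bar \<Longrightarrow> P (Suc k) = rhs k + s * \<mu>"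
  using path[of k] by (simp add: le_bar_iff max_def split: if_splits)

lemma P_normal: "\<not> P (Suc k) \<le> bar \<Longrightarrow> D * P (Suc k) = rhs k"
  using path[of k] by (simp add: le_bar_iff D_def max_def algebra_simps split: if_splits)

lemma binds_iff: "P (Suc k) \<le> bar \<longleftrightarrow> rhs k + s * \<mu> \<le> bar"
proof
  assume "rhs k + s * \<mu> \<le> bar"
  then have "rhs k \<le> D * bar"
    using D_bar by simp
  then show "P (Suc k) \<le> bar"
    using P_normal[of k] D_gt_1 mult_le_cancel_left_pos[of D "P (Suc k)" bar] by fastforce
qed (use P_elb in simp)

text \<open>Separates the gap to the steady state from a momentum term, which is nonpositive along a
  falling path.\<close>

lemma rhs_normal: "rhs k = D * P k - (FN * P k + s * d) + x * a * (P k - P (k - 1))"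
  by (simp add: rhs_def FN_def algebra_simps)

lemma rhs_elb: "rhs k + s * \<mu> = P k - (FL * P k + s * (d - \<mu>)) + x * a * (P k - P (k - 1))"
  by (simp add: rhs_def FL_def algebra_simps)

lemma rhs_decline:
  assumes "bar < P k" "P k \<le> P (k - 1)"
  shows "rhs k \<le> D * P k - slack"
proof -
  have "x * a * (P k - P (k - 1)) \<le> 0"
    using assms xa by (simp add: mult_nonneg_nonpos)
  moreover have "FN * bar \<le> FN * P k"
    using assms FN_pos by simp
  ultimately show ?thesis
    by (simp add: rhs_normal slack_def)
qed

text \<open>Above \<open>bar\<close> the gap term is at least \<open>slack\<close> and momentum only
  adds to the fall, so each normal period lowers inflation by at least \<open>slack / D\<close>.
  Monotonicity is carried through the induction to sign the momentum term.\<close>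

lemma normal_phase:
  assumes "\<forall>j<k. bar < P j"
  shows "P k \<le> P (k - 1) \<and> (bar < P k \<longrightarrow> P k \<le> - (real k * (slack / D)))"
  using assms
proof (induction k)
  case 0
  then show ?case by (simp add: P_0)
next
  case (Suc k)
  then have k: "bar < P k" "P k \<le> P (k - 1)" "P k \<le> - (real k * (slack / D))"
    by auto
  have D: "D > 0"
    using D_gt_1 by simp
  show ?case
  proof (cases "P (Suc k) \<le> bar")
    case False
    have "D * P (Suc k) \<le> D * P k - slack"
      using rhs_decline[OF k(1,2)] P_normal[OF False] by simp
    then have le: "P (Suc k) \<le> P k - slack / D"
      using D by (simp add: field_simps)
    moreover have "slack / D > 0"
      using slack_pos D by simp
    moreover have "real (Suc k) * (slack / D) = real k * (slack / D) + slack / D"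
      by (simp only: of_nat_Suc distrib_right mult_1_left)
    ultimately show ?thesis
      using k(3) by simp
  qed (use k in simp)
qed

lemma crosses: "\<exists>k. P k \<le> bar"
proof (rule ccontr)
  assume "\<nexists>k. P k \<le> bar"
  then have gt: "bar < P k" for k
    by (simp add: not_le)
  have "slack / D > 0"
    using slack_pos D_gt_1 by simp
  then obtain n where "- bar < real n * (slack / D)"
    using reals_Archimedean3 by blast
  moreover have "P n \<le> - (real n * (slack / D))"
    using normal_phase[of n] gt by blast
  ultimately show False
    using gt[of n] by simp
qed

definition L where "L = (LEAST k. P k \<le> bar)"

lemma P_L: "P L \<le> bar"
  unfolding L_def using crosses by (rule LeastI_ex)

lemma before_L: "k < L \<Longrightarrow> bar < P k"
  unfolding L_def by (drule not_less_Least) simp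

lemma decline: "k \<le> L \<Longrightarrow> P k \<le> P (k - 1)"
  using normal_phase[of k] before_L by simp

text \<open>By \<open>d_upper\<close> a one-period shock does not reach the ELB. Hence the last
  low-state period is always normal, and \<open>L - 2\<close> is a genuine index in
  \<open>Q_entry\<close>.\<close>

lemma L_ge_2: "L \<ge> 2"
proof -
  have "P 0 > bar"
    using bar_neg by (simp add: P_0)
  moreover have "\<not> P (Suc 0) \<le> bar"
  proof
    assume "P (Suc 0) \<le> bar"
    then have "- s * d + s * \<mu> \<le> bar"
      unfolding binds_iff by (simp add: rhs_def P_0)
    then have "\<psi> * (s * (\<mu> - d)) \<le> \<psi> * bar"
      using \<psi> by (intro mult_left_mono) (simp_all add: algebra_simps)
    then show False
      using \<psi>_bar d_upper by (simp add: algebra_simps)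
  qed
  ultimately have "L \<noteq> 0" "L \<noteq> Suc 0"
    using P_L by (metis not_le)+
  then show ?thesis by simp
qed

text \<open>
  With a determinate ELB regime inflation falls until it undershoots the ELB steady state
  \<open>E\<close>; from then on consumption and inflation are both below their ELB steady-state values, a
  property that the nonnegative ELB matrix preserves. The condition \<open>P k - E \<le> a * (P (k - 1) - E)\<close>
  says this for consumption.
\<close>

lemma after_L_determinate:
  assumes FL: "FL > 0" and "k \<ge> L"
  defines "E \<equiv> - s * (d - \<mu>) / FL"
  shows "P k \<le> bar \<and> (E \<le> P k \<and> P k \<le> P (k - 1) \<or> P k \<le> E \<and> P k - E \<le> a * (P (k - 1) - E))"
  using \<open>k \<ge> L\<close>
proof (induction k rule: dec_induct)
  have FLE: "FL * E = - s * (d - \<mu>)"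
    using FL by (simp add: E_def)
  have "FL * (bar - E) > 0"
    using slack_pos by (simp add: slack_eq right_diff_distrib FLE)
  then have E: "E < bar"
    using FL by (simp add: zero_less_mult_iff)
  {
    case base
    \<comment> \<open>The path enters from above \<open>E\<close>, so either alternative of the
      invariant can hold at \<open>L\<close>, depending on whether the first step below
      \<open>bar\<close> overshoots \<open>E\<close>.\<close>
    have "E \<le> P (L - 1)"
      using before_L[of "L - 1"] L_ge_2 E by simp
    then have "0 \<le> a * (P (L - 1) - E)"
      using a by simp
    then show ?case
      using P_L decline[of L] by linarith
  next
    case (step k)
    from step.IH consider
        (fall) "E \<le> P k" "P k \<le> P (k - 1)"
      | (low) "P k \<le> E" "P k - E \<le> a * (P (k - 1) - E)"
      by blast
    then show ?case
    proof cases
      case fall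
      have "x * a * (P k - P (k - 1)) \<le> 0" "0 \<le> FL * (P k - E)" "0 \<le> a * (P k - E)"
        using fall xa FL a by (auto simp: mult_nonneg_nonpos)
      then have "rhs k + s * \<mu> \<le> P k"
        using FLE unfolding rhs_elb by (simp add: right_diff_distrib)
      then have "P (Suc k) \<le> bar" "P (Suc k) \<le> P k"
        using step.IH P_elb[of k] by (auto simp: binds_iff)
      then show ?thesis
        using \<open>0 \<le> a * (P k - E)\<close> by auto
    next
      case low
      \<comment> \<open>The bracket multiplying \<open>x\<close> is the consumption gap scaled by
        the Phillips slope; nonnegative coefficients keep both gaps nonpositive.\<close>
      have "rhs k + s * \<mu> - E = x * (P k - E - a * (P (k - 1) - E)) + (a + s * q) * (P k - E)"
        using FLE by (simp add: rhs_def FL_def T_def algebra_simps)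
      moreover have "x * (P k - E - a * (P (k - 1) - E)) \<le> 0" "s * q * (P k - E) \<le> 0"
          "a * (P k - E) \<le> 0"
        using low x s q a by (auto simp: mult_nonneg_nonpos)
      ultimately have *: "rhs k + s * \<mu> - E \<le> a * (P k - E)" "rhs k + s * \<mu> \<le> E"
        by (simp_all add: distrib_right)
      then have "P (Suc k) \<le> bar"
        using E by (simp add: binds_iff)
      then show ?thesis
        using * P_elb[of k] by simp
    qed
  }
qed

text \<open>For \<open>FL \<le> 0\<close> the product \<open>FL * P k\<close> is at least
  \<open>FL * bar\<close> below \<open>bar\<close>, so the drop per period is at least
  \<open>slack\<close>.\<close>

lemma after_L_indeterminate:
  assumes FL: "FL \<le> 0" and "k \<ge> L"
  shows "P k \<le> bar \<and> P k \<le> P (k - 1)"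
  using \<open>k \<ge> L\<close>
proof (induction k rule: dec_induct)
  case base
  then show ?case
    using P_L decline[of L] by simp
next
  case (step k)
  have "x * a * (P k - P (k - 1)) \<le> 0"
    using step.IH xa by (simp add: mult_nonneg_nonpos)
  moreover have "FL * bar \<le> FL * P k"
    using step.IH FL by (simp add: mult_left_mono_neg)
  ultimately have "rhs k + s * \<mu> \<le> P k"
    using slack_pos slack_eq unfolding rhs_elb by linarith
  then have "P (Suc k) \<le> bar" "P (Suc k) \<le> P k"
    using step.IH P_elb[of k] by (auto simp: binds_iff)
  then show ?case by simp
qed

lemma binds_iff_L: "P k \<le> bar \<longleftrightarrow> L \<le> k"
proof
  assume "L \<le> k"
  then show "P k \<le> bar"
    using after_L_determinate[of k] after_L_indeterminate[of k] by (cases "FL > 0") auto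
next
  assume "P k \<le> bar"
  then show "L \<le> k"
    using before_L[of k] by (meson not_le)
qed

text \<open>Since \<open>T\<close> exceeds \<open>x + a\<close>, the discriminant is at least
  \<open>(x - a)\<^sup>2\<close>, so the roots are real; the smaller one is below 1 because the
  product is.\<close>

lemma characteristic_roots:
  obtains z1 z2 where "z1 + z2 = T" "z1 * z2 = x * a" "0 < z1" "z1 < 1" "0 < z2"
    "(1 - z1) * (1 - z2) = FL"
proof -
  define r where "r = sqrt (T\<^sup>2 - 4 * (x * a))"
  have "(x + a)\<^sup>2 \<le> T\<^sup>2"
    using x a s q by (intro power_mono) (auto simp: T_def)
  moreover have "(x + a)\<^sup>2 - 4 * (x * a) = (x - a)\<^sup>2"
    by (simp add: power2_eq_square algebra_simps)
  moreover have "(x - a)\<^sup>2 \<ge> 0"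
    by simp
  ultimately have "0 \<le> T\<^sup>2 - 4 * (x * a)"
    by linarith
  then have r: "r\<^sup>2 = T\<^sup>2 - 4 * (x * a)" "r \<ge> 0"
    by (simp_all add: r_def)
  define z1 z2 where "z1 = (T - r) / 2" and "z2 = (T + r) / 2"
  have sum: "z1 + z2 = T" and le: "z1 \<le> z2"
    using r by (simp_all add: z1_def z2_def field_simps)
  have "T > 0"
    using x a s q by (simp add: T_def add_pos_pos)
  have prod: "z1 * z2 = x * a"
    using r(1) by (simp add: z1_def z2_def power2_eq_square algebra_simps)
  have "z2 > 0"
    using sum le \<open>T > 0\<close> by linarith
  then have "z1 > 0"
    using prod xa(1) by (metis zero_less_mult_pos2)
  have "z1 < 1"
  proof (rule ccontr)
    assume "\<not> z1 < 1"
    then have "1 * 1 \<le> z1 * z2"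
      using le by (intro mult_mono) auto
    then show False
      using prod xa by simp
  qed
  moreover have "(1 - z1) * (1 - z2) = FL"
    using sum prod by (simp add: FL_def algebra_simps)
  ultimately show ?thesis
    using that sum prod \<open>z1 > 0\<close> \<open>z2 > 0\<close> by blast
qed

end

section \<open>The spending multiplier along the inflation path\<close>

text \<open>\<open>C\<close> and \<open>Q\<close> are the derivatives of consumption and inflation
  in \<open>g\<close>, with regimes frozen along \<open>P\<close>; constants independent of
  \<open>g\<close> drop out. Here \<open>\<kappa>\<close> stands for the full Phillips slope
  \<open>K M\<close>.\<close>

locale multiplier_path = inflation_path +
  fixes \<sigma> \<kappa> G :: real and C Q :: "nat \<Rightarrow> real"
  assumes \<sigma>: "0 < \<sigma>" and \<kappa>: "0 < \<kappa>" and s_eq: "s = \<sigma> * \<kappa>" and G: "0 < G"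
    and C_0: "C 0 = 0" and Q_0: "Q 0 = 0"
    and Q_Suc: "Q (Suc k) = a * Q k + \<kappa> * C (Suc k) + G"
    and C_elb: "P (Suc k) \<le> - \<mu> / \<psi> \<Longrightarrow> C (Suc k) = x * C k + \<sigma> * q * Q k"
    and C_normal: "\<not> P (Suc k) \<le> - \<mu> / \<psi> \<Longrightarrow>
          C (Suc k) = x * C k - \<sigma> * (\<psi> * Q (Suc k) - q * Q k)"
begin

lemma C_elb': "L \<le> Suc k \<Longrightarrow> C (Suc k) = x * C k + \<sigma> * q * Q k"
  by (intro C_elb) (simp only: bar_def[symmetric] binds_iff_L)

lemma C_normal': "Suc k < L \<Longrightarrow> C (Suc k) = x * C k - \<sigma> * (\<psi> * Q (Suc k) - q * Q k)"
  by (intro C_normal) (simp only: bar_def[symmetric] binds_iff_L not_le)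

text \<open>The Phillips curve is the same in both regimes, so only the newest date must be at the
  ELB: the recursion already produces \<open>Q L\<close> from the normal values
  \<open>Q (L - 1)\<close> and \<open>Q (L - 2)\<close>.\<close>

lemma Q_elb:
  assumes "Suc (Suc k) \<ge> L"
  shows "Q (Suc (Suc k)) = T * Q (Suc k) - x * a * Q k + G * (1 - x)"
proof -
  have C: "C (Suc (Suc k)) = x * C (Suc k) + \<sigma> * q * Q (Suc k)"
    using assms by (rule C_elb')
  have "\<kappa> * C (Suc (Suc k)) = x * (\<kappa> * C (Suc k)) + s * q * Q (Suc k)"
    unfolding C s_eq by (simp add: algebra_simps)
  moreover have "\<kappa> * C (Suc k) = Q (Suc k) - a * Q k - G"
    by (simp add: Q_Suc)
  ultimately have "\<kappa> * C (Suc (Suc k)) = x * (Q (Suc k) - a * Q k - G) + s * q * Q (Suc k)"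
    by simp
  then show ?thesis
    by (simp add: Q_Suc[of "Suc k"] T_def algebra_simps)
qed

lemma Q_normal:
  assumes "Suc (Suc k) < L"
  shows "D * Q (Suc (Suc k)) = T * Q (Suc k) - x * a * Q k + G * (1 - x)"
proof -
  have C: "C (Suc (Suc k)) = x * C (Suc k) - \<sigma> * (\<psi> * Q (Suc (Suc k)) - q * Q (Suc k))"
    using assms by (rule C_normal')
  have "\<kappa> * C (Suc (Suc k))
      = x * (\<kappa> * C (Suc k)) - s * \<psi> * Q (Suc (Suc k)) + s * q * Q (Suc k)"
    unfolding C s_eq by (simp add: algebra_simps)
  moreover have "\<kappa> * C (Suc k) = Q (Suc k) - a * Q k - G"
    by (simp add: Q_Suc)
  ultimately have "\<kappa> * C (Suc (Suc k))
      = x * (Q (Suc k) - a * Q k - G) - s * \<psi> * Q (Suc (Suc k)) + s * q * Q (Suc k)"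
    by simp
  then show ?thesis
    using Q_Suc[of "Suc k"] by (simp add: D_def T_def algebra_simps)
qed

lemma Q_1: "D * Q (Suc 0) = G"
proof -
  have "C (Suc 0) = - \<sigma> * \<psi> * Q (Suc 0)"
    using C_normal'[of 0] L_ge_2 by (simp add: C_0 Q_0)
  then have "\<kappa> * C (Suc 0) = - s * \<psi> * Q (Suc 0)"
    unfolding s_eq by simp
  then show ?thesis
    using Q_Suc[of 0] by (simp add: Q_0 D_def algebra_simps)
qed

text \<open>
  In the normal-time regime both the inflation path and its multiplier solve the same linear
  recursion, which ties the sign of the multiplier to the monotonicity of the path.
\<close>

lemma Q_eq_P: "k < L \<Longrightarrow> - s * d * Q k = G * (P k - x * P (k - 1))"
proof (induction k rule: less_induct)
  case (less k)
  have D: "D \<noteq> 0"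
    using D_gt_1 by simp
  consider "k = 0" | "k = Suc 0" | j where "k = Suc (Suc j)"
    by (metis not0_implies_Suc)
  then show ?case
  proof cases
    case 1
    then show ?thesis by (simp add: Q_0 P_0)
  next
    case 2
    have "D * P (Suc 0) = - s * d"
      using P_normal[of 0] binds_iff_L[of "Suc 0"] L_ge_2 by (simp add: rhs_def P_0)
    then have "D * (- s * d * Q (Suc 0)) = D * (G * P (Suc 0))"
      using Q_1 by (metis mult.left_commute mult.commute)
    then have "- s * d * Q (Suc 0) = G * P (Suc 0)"
      using D by (simp only: mult_cancel_left simp_thms)
    then show ?thesis
      using 2 by (simp add: P_0)
  next
    case 3
    have P2: "D * P (Suc (Suc j)) = rhs (Suc j)" and P1: "D * P (Suc j) = rhs j"
      using less.prems 3 by (auto intro!: P_normal simp: binds_iff_L)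
    have IH: "- s * d * Q (Suc j) = G * (P (Suc j) - x * P j)"
        "- s * d * Q j = G * (P j - x * P (j - 1))"
      using less.IH[of "Suc j"] less.IH[of j] less.prems 3 by simp_all
    have "D * (- s * d * Q k) = - s * d * (T * Q (Suc j) - x * a * Q j + G * (1 - x))"
      using Q_normal[of j] less.prems 3 by (metis mult.left_commute)
    also have "\<dots> = T * (- s * d * Q (Suc j)) - x * a * (- s * d * Q j) - s * d * G * (1 - x)"
      by (simp add: algebra_simps)
    \<comment> \<open>The forcing terms match: the constant in
      \<open>rhs (Suc j) - x * rhs j\<close> is \<open>- s * d * (1 - x)\<close>.\<close>
    also have "\<dots> = G * (rhs (Suc j) - x * rhs j)"
      unfolding IH by (simp add: rhs_def algebra_simps)
    also have "\<dots> = D * (G * (P k - x * P (k - 1)))"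
      unfolding P1[symmetric] P2[symmetric] 3 by (simp add: algebra_simps)
    finally show ?thesis
      using D by (simp only: mult_cancel_left simp_thms)
  qed
qed

lemma P_nonpos: "k \<le> L \<Longrightarrow> P k \<le> 0"
proof (induction k)
  case (Suc k)
  then show ?case using decline[of "Suc k"] by simp
qed (simp add: P_0)

lemma Q_nonneg:
  assumes "k < L"
  shows "Q k \<ge> 0"
proof -
  have "P k \<le> P (k - 1)" "P (k - 1) \<le> 0"
    using decline[of k] P_nonpos[of "k - 1"] assms by auto
  then have "P k - x * P (k - 1) \<le> 0"
    using x mult_right_mono_neg[of x 1 "P (k - 1)"] by simp
  then have "- s * d * Q k \<le> 0"
    using G Q_eq_P[OF assms] by (simp add: mult_nonneg_nonpos)
  then have "0 \<le> s * d * Q k"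
    by simp
  then show ?thesis
    using mult_pos_pos[OF s d_pos] by (simp only: zero_le_mult_iff) auto
qed

text \<open>
  The component of the multiplier in the direction of the dominant root \<open>z2\<close> is positive on
  entry into the ELB regime.
\<close>

lemma Q_entry:
  assumes roots: "z1 + z2 = T" "z1 * z2 = x * a" "0 < z1" "z1 < 1" "1 \<le> z2"
  shows "z1 * Q (L - 2) < Q (L - 1)"
proof -
  define k where "k = L - 2"
  have k: "L = Suc (Suc k)"
    using L_ge_2 by (simp add: k_def)
  have gt: "bar < P (Suc k)"
    using before_L k by simp
  have dec: "P (Suc k) \<le> P k" "P k \<le> P (k - 1)"
    using decline[of "Suc k"] decline[of k] k by auto
  have "D * P (Suc k) = rhs k"
    using P_normal[of k] gt by simp
  \<comment> \<open>At \<open>L - 1\<close> inflation is still above \<open>bar\<close>, so the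
    normal-time gap is positive and bounds the next right-hand side by momentum alone.\<close>
  moreover have "FN * bar < FN * P (Suc k)"
    using gt FN_pos by simp
  then have "FN * P (Suc k) + s * d > 0"
    using slack_pos by (simp add: slack_def)
  ultimately have "rhs (Suc k) - rhs k < x * a * (P (Suc k) - P k)"
    using rhs_normal[of "Suc k"] by simp
  then have "(T - x * a) * (P (Suc k) - P k) < x * a * (P k - P (k - 1))"
    by (simp add: rhs_def algebra_simps)
  \<comment> \<open>\<open>T - x * a = z2 + z1 * (1 - z2)\<close>, and
    \<open>z2 \<ge> 1\<close>.\<close>
  moreover have "T - x * a \<le> z2"
    using roots mult_left_mono[of 1 z2 z1]
    by (metis add.commute diff_le_eq less_imp_le mult.right_neutral add_left_mono)
  then have "z2 * (P (Suc k) - P k) \<le> (T - x * a) * (P (Suc k) - P k)"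
    using dec by (simp add: mult_right_mono_neg)
  ultimately have "z2 * (P (Suc k) - P k) < z1 * z2 * (P k - P (k - 1))"
    unfolding roots(2) by linarith
  then have "z2 * (P (Suc k) - P k) < z2 * (z1 * (P k - P (k - 1)))"
    by (simp only: mult.assoc mult.left_commute)
  then have *: "P (Suc k) - P k < z1 * (P k - P (k - 1))"
    using roots by simp
  \<comment> \<open>Passes from differences of \<open>P\<close> to
    \<open>P k - x * P (k - 1)\<close>, which is proportional to \<open>Q k\<close> by
    \<open>Q_eq_P\<close>.\<close>
  have "z1 * (P k - P (k - 1)) \<le> x * (z1 * (P k - P (k - 1)))"
    using dec roots x mult_right_mono_neg[of x 1 "z1 * (P k - P (k - 1))"]
    by (simp add: mult_nonneg_nonpos)
  moreover have "(1 - x) * (1 - z1) * P k \<le> 0"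
    using P_nonpos[of k] k x roots by (simp add: mult_nonneg_nonpos)
  ultimately have "(P (Suc k) - x * P k) - z1 * (P k - x * P (k - 1)) < 0"
    using * by (simp add: algebra_simps)
  then have "G * ((P (Suc k) - x * P k) - z1 * (P k - x * P (k - 1))) < 0"
    using G by (simp add: mult_pos_neg)
  also have "G * ((P (Suc k) - x * P k) - z1 * (P k - x * P (k - 1)))
      = - s * d * Q (Suc k) - z1 * (- s * d * Q k)"
    using Q_eq_P[of "Suc k"] Q_eq_P[of k] k by (simp only: right_diff_distrib mult.left_commute) simp
  also have "\<dots> = s * d * (z1 * Q k - Q (Suc k))"
    by (simp add: algebra_simps)
  finally have "z1 * Q k < Q (Suc k)"
    using s d_pos by (simp add: mult_less_0_iff)
  then show ?thesis
    by (simp add: k)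
qed

text \<open>Subtracting \<open>z1 * Q\<close> filters out the \<open>z1\<close>-component. The
  remainder starts positive and has factor \<open>z2 \<ge> 1\<close> with positive forcing, so it
  grows at least linearly, even for \<open>z2 = 1\<close>; \<open>Q\<close> and then
  \<open>C\<close> inherit this.\<close>

lemma C_diverges:
  assumes FL: "FL \<le> 0"
  shows "filterlim C at_top sequentially"
proof -
  obtain z1 z2 where z: "z1 + z2 = T" "z1 * z2 = x * a" "0 < z1" "z1 < 1"
      "0 < z2" "(1 - z1) * (1 - z2) = FL"
    by (rule characteristic_roots)
  have z2: "1 \<le> z2"
    using z FL mult_pos_pos[of "1 - z1" "1 - z2"] by linarith
  define N where "N = L - 2"
  have N: "L = Suc (Suc N)"
    using L_ge_2 by (simp add: N_def)
  define v where "v j = Q (Suc (N + j)) - z1 * Q (N + j)" for j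
  have v_Suc: "v (Suc j) = z2 * v j + G * (1 - x)" for j
  proof -
    have "Q (Suc (Suc (N + j))) = (z1 + z2) * Q (Suc (N + j)) - z1 * z2 * Q (N + j) + G * (1 - x)"
      using Q_elb[of "N + j"] N z by simp
    then show ?thesis
      by (simp add: v_def algebra_simps)
  qed
  have v: "v j \<ge> real j * (G * (1 - x)) \<and> v j \<ge> 0" for j
  proof (induction j)
    case 0
    have "z1 * Q N < Q (Suc N)"
      using Q_entry[OF z(1-4) z2] N by simp
    then show ?case
      by (simp add: v_def)
  next
    case (Suc j)
    then have "v j \<le> z2 * v j"
      using z2 mult_right_mono[of 1 z2 "v j"] by simp
    moreover have "G * (1 - x) > 0"
      using G x by simp
    ultimately show ?case
      using Suc by (auto simp: v_Suc distrib_right)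
  qed
  have Q: "Q (N + j) \<ge> 0" for j
  proof (induction j)
    case 0
    then show ?case using Q_nonneg[of N] N by simp
  next
    case (Suc j)
    then have "0 \<le> z1 * Q (N + j)" using z by simp
    then show ?case using v[of j] by (simp add: v_def)
  qed
  have Q_ge: "Q (Suc (N + j)) \<ge> real j * (G * (1 - x))" for j
  proof -
    have "0 \<le> z1 * Q (N + j)" using z Q by simp
    then show ?thesis using v[of j] by (simp add: v_def)
  qed
  have C_Suc: "C (Suc (Suc N + j)) = x * C (Suc N + j) + \<sigma> * q * Q (Suc N + j)" for j
    using N by (simp add: C_elb')
  \<comment> \<open>The sign of consumption on entry is left open; \<open>- B\<close> is a lower
    bound preserved by the factor \<open>x < 1\<close> and the nonnegative source.\<close>
  define B where "B = \<bar>C (Suc N)\<bar>"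
  have C_bound: "C (Suc N + j) \<ge> - B" for j
  proof (induction j)
    case (Suc j)
    have "0 \<le> \<sigma> * q * Q (Suc N + j)"
      using \<sigma> q Q[of "Suc j"] by simp
    moreover have "- B \<le> x * (- B)"
      using x mult_right_mono[of x 1 B] by (simp add: B_def)
    moreover have "x * (- B) \<le> x * C (Suc N + j)"
      using Suc x by (intro mult_left_mono) auto
    ultimately show ?case
      using C_Suc[of j] by simp
  qed (simp add: B_def)
  have C_ge: "C (j + (Suc (Suc N))) \<ge> - B + real j * (\<sigma> * q * (G * (1 - x)))" for j
  proof -
    have "- B \<le> x * (- B)"
      using x mult_right_mono[of x 1 B] by (simp add: B_def)
    moreover have "x * (- B) \<le> x * C (Suc N + j)"
      using C_bound[of j] x by (intro mult_left_mono) auto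
    moreover have "\<sigma> * q * (real j * (G * (1 - x))) \<le> \<sigma> * q * Q (Suc N + j)"
      using \<sigma> q Q_ge[of j] by (intro mult_left_mono) auto
    ultimately show ?thesis
      using C_Suc[of j] by (simp add: add.commute mult.left_commute)
  qed
  have "0 < \<sigma> * q * (G * (1 - x))"
    using \<sigma> q G x by simp
  then have "filterlim (\<lambda>j. - B + real j * (\<sigma> * q * (G * (1 - x)))) at_top sequentially"
    by (intro filterlim_tendsto_add_at_top[OF tendsto_const]
        filterlim_at_top_mult_tendsto_pos[OF tendsto_const] filterlim_real_sequentially)
  then have lim: "filterlim (\<lambda>j. C (j + Suc (Suc N))) at_top sequentially"
    by (rule filterlim_at_top_mono) (use C_ge in \<open>blast intro: always_eventually\<close>)
  show ?thesis
    unfolding filterlim_at_top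
  proof
    fix Z
    show "eventually (\<lambda>j. Z \<le> C j) sequentially"
      using lim eventually_sequentially_seg[of "\<lambda>j. Z \<le> C j" "Suc (Suc N)"]
      unfolding filterlim_at_top by blast
  qed
qed

text \<open>A cascade of three first-order recursions with factors \<open>z2\<close>,
  \<open>z1\<close> and \<open>x\<close>, solved in turn.\<close>

lemma C_converges:
  assumes FL: "FL > 0"
  shows "C \<longlonglongrightarrow> \<sigma> * q * G / FL"
proof -
  obtain z1 z2 where z: "z1 + z2 = T" "z1 * z2 = x * a" "0 < z1" "z1 < 1"
      "0 < z2" "(1 - z1) * (1 - z2) = FL"
    by (rule characteristic_roots)
  have z2: "z2 < 1"
    using z FL mult_nonneg_nonpos[of "1 - z1" "1 - z2"] by linarith
  define v where "v k = Q (Suc k) - z1 * Q k" for k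
  have "v (Suc k) = z2 * v k + G * (1 - x)" if "k \<ge> L" for k
  proof -
    have "Q (Suc (Suc k)) = (z1 + z2) * Q (Suc k) - z1 * z2 * Q k + G * (1 - x)"
      using Q_elb[of k] that z by simp
    then show ?thesis
      by (simp add: v_def algebra_simps)
  qed
  then have "v \<longlonglongrightarrow> G * (1 - x) / (1 - z2)"
    by (rule affine_recursion_tendsto[of L v z2, OF _ _ tendsto_const]) (use z z2 in auto)
  then have "Q \<longlonglongrightarrow> G * (1 - x) / (1 - z2) / (1 - z1)"
    by (rule affine_recursion_tendsto[of 0 Q z1 v, rotated 2]) (use z in \<open>auto simp: v_def\<close>)
  also have "G * (1 - x) / (1 - z2) / (1 - z1) = G * (1 - x) / FL"
    using z by (simp add: mult.commute)
  finally have "(\<lambda>k. \<sigma> * q * Q k) \<longlonglongrightarrow> \<sigma> * q * (G * (1 - x) / FL)"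
    by (rule tendsto_mult_left)
  then have "C \<longlonglongrightarrow> \<sigma> * q * (G * (1 - x) / FL) / (1 - x)"
    by (rule affine_recursion_tendsto[of L C x, rotated 2]) (use x in \<open>auto intro!: C_elb'\<close>)
  also have "\<sigma> * q * (G * (1 - x) / FL) / (1 - x) = \<sigma> * q * G / FL"
    using x by simp
  finally show ?thesis .
qed

end

section \<open>From the matrix model to the scalar recursions\<close>

definition low_step :: "model \<Rightarrow> real \<Rightarrow> real \<Rightarrow> real \<Rightarrow> real^2 \<Rightarrow> real^2" where
  "low_step M p d g y = (if elb_step M p d g y $ 2 \<le> pibar M then elb_step M p d g y
                         else normal_step M p d g y)"

text \<open>Counting remaining periods instead of dates lets one sequence serve every length
  \<open>l\<close>.\<close>

primrec low_path :: "model \<Rightarrow> real \<Rightarrow> real \<Rightarrow> real \<Rightarrow> nat \<Rightarrow> real^2" where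
  "low_path M p d g 0 = 0"
| "low_path M p d g (Suc k) = low_step M p d g (low_path M p d g k)"

lemma low_alloc_eq_low_path:
  assumes adm: "admissible M" and p: "0 \<le> p" "p \<le> 1"
  shows "low_alloc M p d g l n = low_path M p d g (l - n)"
proof -
  define Y where "Y = (THE Y. equilibrium M p d g l Y)"
  have "equilibrium M p d g l Y"
    unfolding Y_def by (rule theI'[OF equilibrium_ex1[OF adm p]])
  then have Y: "\<And>n. n < l \<Longrightarrow> Y n Low = low_step M p d g (Y (Suc n) Low)"
      "\<And>n. l \<le> n \<Longrightarrow> Y n Low = 0"
    unfolding equilibrium_iff[OF adm p] low_step_def Suc_eq_plus1 by blast+
  have "l - n = k \<Longrightarrow> Y n Low = low_path M p d g k" for k
  proof (induction k arbitrary: n)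
    case 0
    then show ?case using Y(2) by simp
  next
    case (Suc k)
    then have "n < l" "l - Suc n = k" by auto
    then show ?case using Y(1)[of n] Suc.IH[of "Suc n"] by simp
  qed
  then show ?thesis
    by (simp add: low_alloc_def Y_def)
qed

lemma low_path_Suc_inflation:
  fixes M p d
  assumes adm: "admissible M"
  defines "P \<equiv> \<lambda>k. low_path M p d 0 k $ 2"
    and "x \<equiv> p * mxx M" and "a \<equiv> p * beta M * mpipi M" and "q \<equiv> p * mxpi M"
    and "s \<equiv> sig M * K M"
  shows "P (Suc k) + s * max (psi M * P (Suc k)) (- mu M)
           = (x + a + s * q) * P k - x * a * P (k - 1) - s * d"
proof -
  define C where "C k = low_path M p d 0 k $ 1" for k
  define i where "i k = max (psi M * P k) (- mu M)" for k
  \<comment> \<open>Read backwards, \<open>step_iff\<close> turns the regime choice into the policy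
    rule with its max.\<close>
  note step = step_iff[OF adm, THEN iffD2, OF low_path.simps(2)[unfolded low_step_def]]
  have eqs: "C (Suc k) = x * C k - sig M * (i (Suc k) - q * P k + d)"
      "P (Suc k) = a * P k + K M * C (Suc k)" for k
    unfolding C_def P_def x_def a_def q_def i_def
    by (rule trans[OF step[THEN conjunct1]], simp add: policy_rate_def mult_ac del: low_path.simps)
      (rule trans[OF step[THEN conjunct2]], simp add: mult_ac del: low_path.simps)
  have KC: "K M * C k = P k - a * P (k - 1)"
  proof (cases k)
    case (Suc j)
    then show ?thesis using eqs(2)[of j] by simp
  qed (simp add: C_def P_def)
  have "P (Suc k) = a * P k + x * (K M * C k) - s * (i (Suc k) - q * P k + d)"
    unfolding eqs(2) eqs(1) s_def by (simp add: algebra_simps)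
  then show ?thesis
    unfolding KC by (simp add: i_def algebra_simps)
qed

primrec regime_multiplier :: "model \<Rightarrow> real \<Rightarrow> (nat \<Rightarrow> bool) \<Rightarrow> nat \<Rightarrow> real^2" where
  "regime_multiplier M p b 0 = 0"
| "regime_multiplier M p b (Suc k) =
     (if b (Suc k) then (p *\<^sub>R mat_A_elb M) *v regime_multiplier M p b k + vec_Cg_elb M
      else (p *\<^sub>R mat_A M) *v regime_multiplier M p b k + vec_Cg M)"

text \<open>Frozen regimes make every step affine in \<open>g\<close>. Date \<open>l - j\<close> has
  \<open>j\<close> periods remaining, hence the reindexing of \<open>R\<close>.\<close>

lemma fixed_regime_alloc_affine:
  "fixed_regime_alloc M p d g R l k
     = fixed_regime_alloc M p d 0 R l k + g *\<^sub>R regime_multiplier M p (\<lambda>j. R (l - j)) k"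
  by (induction k)
    (simp_all add: elb_step_def normal_step_def matrix_vector_right_distrib
      matrix_vector_mult_scaleR scaleR_add_right add_ac)

lemma regime_multiplier_cong:
  "(\<And>j. 1 \<le> j \<Longrightarrow> j \<le> k \<Longrightarrow> b j = b' j) \<Longrightarrow> regime_multiplier M p b k = regime_multiplier M p b' k"
  by (induction k) simp_all

lemma m_S_eq:
  assumes "admissible M" "0 \<le> p" "p \<le> 1"
  shows "m_S M p d l = regime_multiplier M p (\<lambda>k. low_path M p d 0 k $ 2 \<le> pibar M) l $ 1"
proof -
  let ?X = "regime_multiplier M p (\<lambda>j. elb_binds M p d l (l - j)) l"
  let ?F = "\<lambda>g. fixed_regime_alloc M p d g (elb_binds M p d l) l l $ 1"
  have F: "?F = (\<lambda>g. ?F 0 + g * ?X $ 1)"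
    by (rule ext, subst fixed_regime_alloc_affine) simp
  have "(?F has_real_derivative ?X $ 1) (at 0)"
    by (subst F) (auto intro!: derivative_eq_intros)
  then have "m_S M p d l = ?X $ 1"
    unfolding m_S_def by (rule DERIV_imp_deriv)
  also have "?X = regime_multiplier M p (\<lambda>k. low_path M p d 0 k $ 2 \<le> pibar M) l"
    by (rule regime_multiplier_cong) (simp add: elb_binds_def low_alloc_eq_low_path[OF assms])
  finally show ?thesis .
qed

lemma regime_multiplier_elb:
  fixes M p b k
  defines "X \<equiv> regime_multiplier M p b"
  assumes "b (Suc k)"
  shows "X (Suc k) $ 1 = p * mxx M * X k $ 1 + sig M * (p * mxpi M) * X k $ 2"
    and "X (Suc k) $ 2 = p * beta M * mpipi M * X k $ 2 + K M * X (Suc k) $ 1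
           + kappa M * eta M * (1 - cbar M)"
  using \<open>b (Suc k)\<close> unfolding X_def
  by (simp_all add: mat_A_elb_def vec_Cg_elb_def matrix_vector_mult_def sum_2 algebra_simps)

text \<open>\<open>mat_A\<close> is the system already solved for current inflation in the policy
  rule; multiplying by \<open>D\<close> undoes this.\<close>

lemma regime_multiplier_normal:
  fixes M p b k
  defines "X \<equiv> regime_multiplier M p b"
  assumes adm: "admissible M" and b: "\<not> b (Suc k)"
  shows "X (Suc k) $ 1 = p * mxx M * X k $ 1
           - sig M * (psi M * X (Suc k) $ 2 - p * mxpi M * X k $ 2)"
    and "X (Suc k) $ 2 = p * beta M * mpipi M * X k $ 2 + K M * X (Suc k) $ 1
           + kappa M * eta M * (1 - cbar M)"
proof -
  define D where "D = 1 + sig M * psi M * K M"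
  have "D > 0"
    using adm K_pos[OF adm] by (simp add: D_def admissible_def add_pos_pos)
  have D: "1 + sig M * psi M * K M = D"
    by (simp add: D_def)
  have 1: "D * X (Suc k) $ 1 = p * mxx M * X k $ 1
      + p * sig M * (mxpi M - psi M * beta M * mpipi M) * X k $ 2
      - kappa M * eta M * (1 - cbar M) * sig M * psi M"
    using b \<open>D > 0\<close> unfolding X_def regime_multiplier.simps mat_A_def vec_Cg_def D
    by (simp add: matrix_vector_mult_def sum_2 field_simps)
  have 2: "D * X (Suc k) $ 2 = p * K M * mxx M * X k $ 1
      + p * (beta M * mpipi M + sig M * K M * mxpi M) * X k $ 2 + kappa M * eta M * (1 - cbar M)"
    using b \<open>D > 0\<close> unfolding X_def regime_multiplier.simps mat_A_def vec_Cg_def D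
    by (simp add: matrix_vector_mult_def sum_2 field_simps)
  have "D * X (Suc k) $ 1 = D * (p * mxx M * X k $ 1 + sig M * (p * mxpi M * X k $ 2))
      - sig M * psi M * (D * X (Suc k) $ 2)"
    unfolding 1 2 by (simp add: D_def algebra_simps)
  also have "\<dots> = D * (p * mxx M * X k $ 1
      - sig M * (psi M * X (Suc k) $ 2 - p * mxpi M * X k $ 2))"
    by (simp add: algebra_simps)
  finally show "X (Suc k) $ 1 = p * mxx M * X k $ 1
      - sig M * (psi M * X (Suc k) $ 2 - p * mxpi M * X k $ 2)"
    using \<open>D > 0\<close> by simp
  have "D * X (Suc k) $ 2 = D * (p * beta M * mpipi M * X k $ 2
      + kappa M * eta M * (1 - cbar M)) + K M * (D * X (Suc k) $ 1)"
    unfolding 1 2 by (simp add: D_def algebra_simps)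
  also have "\<dots> = D * (p * beta M * mpipi M * X k $ 2 + K M * X (Suc k) $ 1
      + kappa M * eta M * (1 - cbar M))"
    by (simp add: algebra_simps)
  finally show "X (Suc k) $ 2 = p * beta M * mpipi M * X k $ 2 + K M * X (Suc k) $ 1
      + kappa M * eta M * (1 - cbar M)"
    using \<open>D > 0\<close> by simp
qed

lemma regime_multiplier_all_normal:
  "(\<And>j. 1 \<le> j \<Longrightarrow> j \<le> k \<Longrightarrow> \<not> b j) \<Longrightarrow>
     regime_multiplier M p b k = (\<Sum>i<k. mat_pow (p *\<^sub>R mat_A M) i) *v vec_Cg M"
proof (induction k)
  case (Suc k)
  define A where "A = p *\<^sub>R mat_A M"
  have "A ** (\<Sum>i<k. mat_pow A i) + mat 1 = (\<Sum>i<Suc k. mat_pow A i)" for k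
    by (induction k) (simp_all add: matrix_add_ldistrib add_ac)
  then have "(\<Sum>i<Suc k. mat_pow A i) *v vec_Cg M
      = A *v ((\<Sum>i<k. mat_pow A i) *v vec_Cg M) + vec_Cg M"
    by (metis matrix_vector_mul_assoc matrix_vector_mul_lid matrix_vector_mult_add_rdistrib)
  then show ?case
    using Suc by (simp add: A_def)
qed simp

lemma m_L_eq:
  assumes "F_L M p \<noteq> 0"
  shows "m_L M p = sig M * (p * mxpi M) * (kappa M * eta M * (1 - cbar M)) / F_L M p"
proof -
  define B where "B = mat 1 - p *\<^sub>R mat_A_elb M"
  define G where "G = kappa M * eta M * (1 - cbar M)"
  \<comment> \<open>The solution given by the adjugate of \<open>B\<close>.\<close>
  define z :: "real^2" where
    "z = (1 / F_L M p) *\<^sub>R vector [sig M * (p * mxpi M) * G, G * (1 - p * mxx M)]"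
  have "invertible B"
    using assms by (simp add: invertible_det_nz F_L_def B_def)
  then have inv: "matrix_inv B ** B = mat 1"
    unfolding invertible_def matrix_inv_def by (metis (mono_tags, lifting) someI_ex)
  have "B *v vector [sig M * (p * mxpi M) * G, G * (1 - p * mxx M)] = F_L M p *\<^sub>R vec_Cg_elb M"
    by (simp add: B_def vec_eq_iff forall_2 matrix_vector_mult_def sum_2 mat_A_elb_def mat_def
        vec_Cg_elb_def F_L_eq G_def algebra_simps)
  then have "B *v z = vec_Cg_elb M"
    using assms by (simp add: z_def matrix_vector_mult_scaleR)
  then have "matrix_inv B *v vec_Cg_elb M = z"
    by (metis inv matrix_vector_mul_assoc matrix_vector_mul_lid)
  then show ?thesis
    by (simp add: m_L_def B_def z_def G_def)
qed

text \<open>\<open>F_L\<close> is positive at 0 and negative at 1, so a wrong sign at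
  \<open>p\<close> would create a root on the wrong side of the unique one.\<close>

lemma F_L_pos_iff:
  assumes adm: "admissible M" and F1: "F_L M 1 < 0" and p: "0 < p" "p < 1"
  shows "F_L M p > 0 \<longleftrightarrow> p < p_bar M"
proof -
  have pb: "0 < p_bar M" "p_bar M < 1" "F_L M (p_bar M) = 0"
    using theI'[OF p_bar_ex1[OF adm F1]] unfolding p_bar_def by auto
  have unique: "r = p_bar M" if "0 < r" "r < 1" "F_L M r = 0" for r
    using p_bar_ex1[OF adm F1] pb that by blast
  have cont: "isCont (F_L M) r" for r
    unfolding F_L_eq[abs_def] by (intro continuous_intros)
  have F0: "F_L M 0 = 1"
    by (simp add: F_L_eq)
  show ?thesis
  proof
    assume pos: "F_L M p > 0"
    obtain r where r: "p \<le> r" "r \<le> 1" "F_L M r = 0"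
      using IVT2[of "F_L M" 1 0 p] pos F1 p cont by auto
    moreover have "r \<noteq> p" "r \<noteq> 1"
      using r pos F1 by auto
    ultimately show "p < p_bar M"
      using unique[of r] p by auto
  next
    assume lt: "p < p_bar M"
    show "F_L M p > 0"
    proof (rule ccontr)
      assume "\<not> F_L M p > 0"
      then obtain r where r: "0 \<le> r" "r \<le> p" "F_L M r = 0"
        using IVT2[of "F_L M" p 0 0] p cont F0 by auto
      then have "r \<noteq> 0"
        using F0 by auto
      then show False
        using unique[of r] r p lt by auto
    qed
  qed
qed

section \<open>Assembly of the three claims\<close>

theorem proposition9:
  fixes M :: model and p d :: real
  assumes "admissible M"
    and "F_L M 1 < 0"
    and "psi M > mxpi M +
           (1 - mxx M) * (beta M * mpipi M - 1) / (kappa M * (1 + eta M * cbar M) * sig M)"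
    and "0 < p" and "p < 1"
    and "d_bar M p < d" and "d < d_bar M 0"
  shows "(\<forall>l. 1 \<le> l \<and> l < l_low M p d \<longrightarrow> m_S M p d l = m_N M p l) \<and>
         (\<exists>lplus. \<forall>l\<ge>lplus. m_S M p d l > 0) \<and>
         (((\<lambda>l. m_S M p d l) \<longlonglongrightarrow> m_L M p) \<longleftrightarrow> p < p_bar M) \<and>
         (\<not> p < p_bar M \<longrightarrow> filterlim (\<lambda>l. m_S M p d l) at_top sequentially)"
proof -
  note adm = assms(1)
  note pos = adm[unfolded admissible_def] K_pos[OF adm]
  have p: "0 \<le> p" "p \<le> 1"
    using assms by simp_all
  define P where "P k = low_path M p d 0 k $ 2" for k
  define X where "X = regime_multiplier M p (\<lambda>k. P k \<le> pibar M)"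
  have s_pos: "sig M * K M > 0"
    using pos by simp
  have unit: "0 < p * mxx M" "p * mxx M < 1" "0 < p * beta M * mpipi M" "p * beta M * mpipi M < 1"
  proof -
    have "p * y < 1" if "y \<le> 1" for y
      using mult_left_mono[OF that p(1)] \<open>p < 1\<close> by linarith
    from this[of "mxx M"] this[of "beta M * mpipi M"]
    show "p * mxx M < 1" "p * beta M * mpipi M < 1"
      using pos by (simp_all add: mult_le_one mult.assoc)
  qed (use assms pos in simp_all)
  \<comment> \<open>The restriction on \<open>psi M\<close> says \<open>F_N M 1 > 0\<close>, and
    lowering \<open>p\<close> from 1 raises each term of \<open>F_N\<close>.\<close>
  have F_N: "F_N M p > 0"
  proof -
    have le: "p * mxx M \<le> mxx M" "p * beta M * mpipi M \<le> beta M * mpipi M" "p * mxpi M \<le> mxpi M"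
      using pos p by (simp_all add: mult_le_cancel_right1 mult.assoc)
    have b: "beta M * mpipi M \<le> 1"
      using pos by (simp add: mult_le_one)
    have "(1 - mxx M) * (beta M * mpipi M - 1) / (sig M * K M) < psi M - mxpi M"
      using assms(3) by (simp add: K_def mult.commute)
    then have "(1 - mxx M) * (beta M * mpipi M - 1) < (psi M - mxpi M) * (sig M * K M)"
      using s_pos by (simp only: pos_divide_less_eq)
    also have "\<dots> \<le> (psi M - p * mxpi M) * (sig M * K M)"
      using le s_pos by (intro mult_right_mono) auto
    finally have "(1 - mxx M) * (beta M * mpipi M - 1) < sig M * K M * (psi M - p * mxpi M)"
      by (simp only: mult.commute)
    moreover have "(1 - mxx M) * (1 - beta M * mpipi M) \<le> (1 - p * mxx M) * (1 - p * beta M * mpipi M)"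
      using le b pos unit by (intro mult_mono) auto
    ultimately show ?thesis
      by (simp add: F_N_def algebra_simps)
  qed
  interpret multiplier_path "p * mxx M" "p * beta M * mpipi M" "p * mxpi M" "sig M * K M"
    "psi M" "mu M" d P "sig M" "K M" "kappa M * eta M * (1 - cbar M)" "\<lambda>k. X k $ 1" "\<lambda>k. X k $ 2"
  proof unfold_locales
    have sp: "sig M * psi M * K M > 0"
      using pos by simp
    show "mu M * ((1 - p * mxx M) * (1 - p * beta M * mpipi M)
        + sig M * K M * (psi M - p * mxpi M)) < sig M * K M * psi M * d"
      using assms(6) sp by (simp add: d_bar_def F_N_def pos_divide_less_eq mult_ac)
    show "sig M * K M * psi M * d < mu M * (1 + sig M * K M * psi M)"
      using assms(7) sp by (simp add: d_bar_def F_N_def pos_less_divide_eq mult_ac)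
    show "X (Suc k) $ 2 = p * beta M * mpipi M * X k $ 2 + K M * X (Suc k) $ 1
        + kappa M * eta M * (1 - cbar M)" for k
      unfolding X_def
      by (cases "P (Suc k) \<le> pibar M")
        (rule regime_multiplier_elb(2) regime_multiplier_normal(2)[OF adm], assumption)+
    show "X (Suc k) $ 1 = p * mxx M * X k $ 1 + sig M * (p * mxpi M) * X k $ 2"
      if "P (Suc k) \<le> - mu M / psi M" for k
      unfolding X_def by (rule regime_multiplier_elb) (use that in \<open>simp add: pibar_def\<close>)
    show "X (Suc k) $ 1 = p * mxx M * X k $ 1
        - sig M * (psi M * X (Suc k) $ 2 - p * mxpi M * X k $ 2)"
      if "\<not> P (Suc k) \<le> - mu M / psi M" for k
      unfolding X_def by (rule regime_multiplier_normal[OF adm]) (use that in \<open>simp add: pibar_def\<close>)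
    show "P (Suc k) + sig M * K M * max (psi M * P (Suc k)) (- mu M)
        = (p * mxx M + p * beta M * mpipi M + sig M * K M * (p * mxpi M)) * P k
          - p * mxx M * (p * beta M * mpipi M) * P (k - 1) - sig M * K M * d" for k
      unfolding P_def by (rule low_path_Suc_inflation[OF adm])
    show "0 < (1 - p * mxx M) * (1 - p * beta M * mpipi M) + sig M * K M * (psi M - p * mxpi M)"
      using F_N by (simp add: F_N_def)
  qed (use unit pos assms in \<open>simp_all add: P_def X_def\<close>)
  have FL: "FL = F_L M p"
    unfolding FL_def T_def F_L_eq by (simp add: algebra_simps)
  have m_S: "m_S M p d l = X l $ 1" for l
    unfolding X_def P_def by (rule m_S_eq[OF adm p])
  have bar: "bar = pibar M"
    by (simp add: bar_def pibar_def)
  have binds: "P k \<le> pibar M \<longleftrightarrow> L \<le> k" for k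
    using binds_iff_L by (simp add: bar)
  have elb: "elb_binds M p d l n \<longleftrightarrow> L \<le> l - n" for l n
    by (simp add: elb_binds_def low_alloc_eq_low_path[OF adm p] P_def[symmetric] binds)
  have thr: "is_elb_threshold M p d L"
    unfolding is_elb_threshold_def elb
  proof (intro conjI allI impI)
    fix l assume l: "L \<le> l"
    show "\<exists>k>0. k < l \<and> (\<forall>n<k. L \<le> l - n) \<and> (\<forall>n. k \<le> n \<and> n < l \<longrightarrow> \<not> L \<le> l - n)"
      \<comment> \<open>Dates up to \<open>l - L\<close> have at least \<open>L\<close> periods
        remaining.\<close>
      using l L_ge_2 by (intro exI[of _ "l - L + 1"]) auto
  qed (use L_ge_2 in auto)
  \<comment> \<open>Comparing the regime on impact at lengths \<open>L'\<close> and \<open>L\<close>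
    excludes both inequalities.\<close>
  have "L' = L" if "is_elb_threshold M p d L'" for L'
  proof -
    have "L \<le> L'"
      using that unfolding is_elb_threshold_def elb by force
    moreover have "\<not> L < L'"
    proof
      assume "L < L'"
      then have "\<forall>n<L. \<not> L \<le> L - n"
        using that L_ge_2 unfolding is_elb_threshold_def elb by simp
      then show False
        using L_ge_2 by (auto dest: spec[of _ "0::nat"])
    qed
    ultimately show ?thesis by simp
  qed
  then have l_low: "l_low M p d = L"
    unfolding l_low_def using thr by (rule the_equality[rotated])
  have normal: "m_S M p d l = m_N M p l" if "l < L" for l
    unfolding m_S m_N_def X_def
    by (subst regime_multiplier_all_normal) (use that in \<open>auto simp: binds\<close>)
  have sign: "F_L M p > 0 \<longleftrightarrow> p < p_bar M"
    using F_L_pos_iff assms by blast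
  have low: "(\<lambda>l. m_S M p d l) \<longlonglongrightarrow> m_L M p" "m_L M p > 0" if "p < p_bar M"
  proof -
    have pos_FL: "F_L M p > 0"
      using that sign by simp
    then show "(\<lambda>l. m_S M p d l) \<longlonglongrightarrow> m_L M p"
      using C_converges by (simp add: FL m_L_eq m_S)
    show "m_L M p > 0"
      using pos_FL pos assms by (simp add: m_L_eq)
  qed
  have high: "filterlim (\<lambda>l. m_S M p d l) at_top sequentially" if "\<not> p < p_bar M"
    using C_diverges sign that by (simp add: FL m_S)
  have "eventually (\<lambda>l. m_S M p d l > 0) sequentially"
  proof (cases "p < p_bar M")
    case True
    then show ?thesis
      using order_tendstoD(1)[OF low] by simp
  next
    case False
    then show ?thesis
      using high by (simp add: filterlim_at_top_dense)
  qed
  \<comment> \<open>Divergence excludes every finite limit, including the arbitrary value that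
    \<open>m_L\<close> takes at \<open>p_bar M\<close>, where the matrix is singular.\<close>
  moreover have "p < p_bar M" if "(\<lambda>l. m_S M p d l) \<longlonglongrightarrow> m_L M p"
    using that high not_tendsto_and_filterlim_at_infinity[OF sequentially_bot that]
      filterlim_at_top_imp_at_infinity by blast
  ultimately show ?thesis
    using normal low(1) high l_low by (auto simp: eventually_sequentially)
qed

end
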